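(* Let $\mathbb{F}$ be a field, and let $A=[a_{i_1,\dots,i_d}]\in\mathbb{F}^{n_1\times\cdots\times n_d}$ and $B=[b_{j_1,\dots,j_r}]\in\mathbb{F}^{m_1\times\cdots\times m_r}$ be hypermatrices. Let $s\le\min(d,r)$, and let $\alpha_1,\dots,\alpha_s\in\{1,\dots,d\}$ be distinct and $\beta_1,\dots,\beta_s\in\{1,\dots,r\}$ be distinct, with $n_{\alpha_t}=m_{\beta_t}=:\ell_t$ for $t=1,\dots,s$. Let $C=A\times^{i_{\alpha_1},\dots,i_{\alpha_s}}_{j_{\beta_1},\dots,j_{\beta_s}}B$ be the contracted product. Then $$M_C^{(i_1,\dots,\hat{i}_{\alpha_1},\dots,\hat{i}_{\alpha_s},\dots,i_d)\times(j_1,\dots,\hat{j}_{\beta_1},\dots,\hat{j}_{\beta_s},\dots,j_r)} =M_A^{(i_1,\dots,\hat{i}_{\alpha_1},\dots,\hat{i}_{\alpha_s},\dots,i_d)\times(i_{\alpha_1},\dots,i_{\alpha_s})}\; M_B^{(j_{\beta_1},\dots,j_{\beta_s})\times(j_1,\dots,\hat{j}_{\beta_1},\dots,\hat{j}_{\beta_s},\dots,j_r)},$$ where a caret means that the entry is omitted and the product on the right-hand side is the conventional matrix product.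
   Context: Write $\langle n\rangle=\{1,\dots,n\}$. A hypermatrix $A=[a_{i_1,\dots,i_d}]\in\mathbb{F}^{n_1\times\cdots\times n_d}$ is a function $\langle n_1\rangle\times\cdots\times\langle n_d\rangle\to\mathbb{F}$. Contracted product: $C=A\times^{i_{\alpha_1},\dots,i_{\alpha_s}}_{j_{\beta_1},\dots,j_{\beta_s}}B$ is the hypermatrix indexed by the remaining indices $i_p$ ($p\notin\{\alpha_1,\dots,\alpha_s\}$, in increasing order of $p$) followed by the remaining indices $j_q$ ($q\notin\{\beta_1,\dots,\beta_s\}$, in increasing order of $q$), with entries $$c_{i_1,\dots,\hat{i}_{\alpha_1},\dots,\hat{i}_{\alpha_s},\dots,i_d,\,j_1,\dots,\hat{j}_{\beta_1},\dots,\hat{j}_{\beta_s},\dots,j_r}=\sum_{k_1=1}^{\ell_1}\cdots\sum_{k_s=1}^{\ell_s}a_{i_1,\dots,i_d}\Big|_{i_{\alpha_t}=k_t,\ t=1,\dots,s}\; b_{j_1,\dots,j_r}\Big|_{j_{\beta_t}=k_t,\ t=1,\dots,s}.$$ Matrix expression: when the indices of a hypermatrix are split into two disjoint ordered lists $\mathbf{r}_1,\mathbf{r}_2$ exhausting all indices (the lists need not be in increasing order), $M_A^{\mathbf{r}_1\times\mathbf{r}_2}$ is the matrix whose rows are indexed by the values of the tuple of indices in $\mathbf{r}_1$, in the listed order, arranged lexicographically (first entry of the list most significant), whose columns are indexed likewise by the values of the tuple of indices in $\mathbf{r}_2$, and whose entries are the corresponding entries of $A$. An empty list gives a single row (respectively,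 column). *)

theory Defs
  imports "Jordan_Normal_Form.Matrix" "HOL-Library.FuncSet"
begin

text \<open>
  Everything is numbered from 0, as for lists and for the type \<open>mat\<close>: index positions of a
  hypermatrix of order \<open>d\<close> are \<open>0, \<dots>, d - 1\<close>, and an index of dimension \<open>n\<close> takes the values
  \<open>0, \<dots>, n - 1\<close>. The order may be 0: contracting all indices yields a hypermatrix with one entry.
\<close>

definition multi_indices :: "nat list \<Rightarrow> nat list set" where
  "multi_indices ns = {xs. list_all2 (<) xs ns}"

typedef 'a hypermatrix =
  "{(ns, f :: nat list \<Rightarrow> 'a). f \<in> extensional (multi_indices ns)}"
  by auto

setup_lifting type_definition_hypermatrix

lift_definition dims :: "'a hypermatrix \<Rightarrow> nat list" is fst .

lift_definition entry :: "'a hypermatrix \<Rightarrow> nat list \<Rightarrow> 'a" is snd .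

lift_definition hypermatrix :: "nat list \<Rightarrow> (nat list \<Rightarrow> 'a) \<Rightarrow> 'a hypermatrix"
  is "\<lambda>ns f. (ns, restrict f (multi_indices ns))"
  by auto

definition hyper_order :: "'a hypermatrix \<Rightarrow> nat" where
  "hyper_order A = length (dims A)"

lemma dims_hypermatrix [simp]: "dims (hypermatrix ns f) = ns"
  by transfer simp

lemma entry_hypermatrix [simp]:
  "xs \<in> multi_indices ns \<Longrightarrow> entry (hypermatrix ns f) xs = f xs"
  by transfer simp

lemma hypermatrix_eqI:
  assumes "dims A = dims B" and "\<And>xs. xs \<in> multi_indices (dims A) \<Longrightarrow> entry A xs = entry B xs"
  shows "A = B"
  using assms by transfer (auto intro: extensionalityI)

definition index_tuples :: "nat list \<Rightarrow> nat list list" where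
  "index_tuples ns = product_lists (map (\<lambda>n. [0..<n]) ns)"

text \<open>The list \<open>index_tuples ns\<close> enumerates the multi-indices in lexicographic order:\<close>

lemma set_index_tuples: "set (index_tuples ns) = multi_indices ns"
  by (auto simp: index_tuples_def multi_indices_def product_lists_set list_all2_conv_all_nth)

lemma sorted_index_tuples:
  "sorted_wrt (\<lambda>xs ys. (xs, ys) \<in> lexord {(a, b). a < b}) (index_tuples ns)"
proof (induction ns)
  case Nil
  then show ?case by (simp add: index_tuples_def)
next
  case (Cons n ns)
  let ?R = "\<lambda>xs ys. (xs, ys) \<in> lexord {(a, b :: nat). a < b}"
  have *: "sorted_wrt ?R (concat (map (\<lambda>x. map ((#) x) (index_tuples ns)) zs))"
    if "sorted_wrt (<) zs" for zs
    using that Cons.IH by (induction zs) (auto simp: sorted_wrt_append sorted_wrt_map)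
  show ?case
    using *[of "[0..<n]"] by (simp add: index_tuples_def)
qed

text \<open>The multi-index of order \<open>d\<close> whose value at position \<open>ks ! t\<close> is \<open>vs ! t\<close>, for all \<open>t\<close>;
  meaningful if \<open>ks\<close> is a permutation of \<open>[0..<d]\<close>.\<close>

definition multi_index :: "nat \<Rightarrow> nat list \<Rightarrow> nat list \<Rightarrow> nat list" where
  "multi_index d ks vs = map (\<lambda>k. the (map_of (zip ks vs) k)) [0..<d]"

lemma multi_index_nth:
  assumes "distinct ks" and "set ks = {..<d}" and "length vs = length ks" and "t < length ks"
  shows "multi_index d ks vs ! (ks ! t) = vs ! t"
proof -
  have "ks ! t < d"
    using assms(2,4) nth_mem by blast
  then show ?thesis
    using assms by (simp add: multi_index_def map_of_zip_nth)
qed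

definition remaining :: "nat \<Rightarrow> nat list \<Rightarrow> nat list" where
  "remaining d ks = filter (\<lambda>k. k \<notin> set ks) [0..<d]"

text \<open>In the contracted product, position \<open>\<alpha> ! t\<close> of \<open>A\<close> is contracted with position \<open>\<beta> ! t\<close> of \<open>B\<close>;
  it is meaningful if these have the same dimension. The tuple \<open>ks\<close> runs over all
  \<open>(k\<^sub>1, \<dots>, k\<^sub>s)\<close>.\<close>

definition contracted_product ::
    "'a :: comm_semiring_0 hypermatrix \<Rightarrow> nat list \<Rightarrow> nat list \<Rightarrow> 'a hypermatrix \<Rightarrow> 'a hypermatrix" where
  "contracted_product A \<alpha> \<beta> B =
    (let p = remaining (hyper_order A) \<alpha>; q = remaining (hyper_order B) \<beta> in
      hypermatrix (map ((!) (dims A)) p @ map ((!) (dims B)) q)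
        (\<lambda>xs. \<Sum>ks \<in> multi_indices (map ((!) (dims A)) \<alpha>).
           entry A (multi_index (hyper_order A) (p @ \<alpha>) (take (length p) xs @ ks)) *
           entry B (multi_index (hyper_order B) (q @ \<beta>) (drop (length p) xs @ ks))))"

text \<open>The matrix expression of \<open>A\<close> with row positions \<open>r1\<close> and column positions \<open>r2\<close>;
  meaningful if \<open>r1 @ r2\<close> is a permutation of \<open>[0..<hyper_order A]\<close>.\<close>

definition matrix_expression :: "'a hypermatrix \<Rightarrow> nat list \<Rightarrow> nat list \<Rightarrow> 'a mat" where
  "matrix_expression A r1 r2 =
    (let rs = index_tuples (map ((!) (dims A)) r1);
         cs = index_tuples (map ((!) (dims A)) r2)
     in mat (length rs) (length cs)
          (\<lambda>(i, j). entry A (multi_index (hyper_order A) (r1 @ r2) (rs ! i @ cs ! j))))"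

end

theory Submission
  imports Defs
begin

text \<open>
  A row of either side is labelled by a multi-index \<open>xs\<close> of the remaining positions of \<open>A\<close>, a column
  by a multi-index \<open>ys\<close> of the remaining positions of \<open>B\<close>. The entry there is the sum over \<open>ks\<close> of the
  entry of \<open>A\<close> at \<open>(xs, ks)\<close> times the entry of \<open>B\<close> at \<open>(ks, ys)\<close>: on the left by the definition of the
  contracted product, on the right because \<open>ks\<close> labels the summation index of the matrix product. As
  the contracted positions have equal dimensions, the columns of the first factor and the rows of the
  second are labelled by the same tuples \<open>ks\<close> in the same order.

  What remains is bookkeeping. The multi-indices are summed as a set on one side and along their
  lexicographic enumeration on the other, which agree because the enumeration has no repetitions
  (\<open>sum_multi_indices\<close>). The contracted positions of \<open>B\<close> are listed last in the contracted product
  and first in the matrix expression, which does not matter as a multi-index depends only on which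
  value is assigned to which position (\<open>multi_index_append_commute\<close>).
\<close>

lemma length_multi_indices: "xs \<in> multi_indices ns \<Longrightarrow> length xs = length ns"
  by (simp add: multi_indices_def list_all2_lengthD)

lemma append_in_multi_indices:
  "xs \<in> multi_indices ns \<Longrightarrow> ys \<in> multi_indices ms \<Longrightarrow> xs @ ys \<in> multi_indices (ns @ ms)"
  by (simp add: multi_indices_def list_all2_appendI)

text \<open>A list that is strictly increasing for an irreflexive relation has no repetitions.\<close>

lemma distinct_index_tuples: "distinct (index_tuples ns)"
proof -
  have "(xs, xs) \<notin> lexord {(a, b :: nat). a < b}" for xs
    by (rule lexord_irreflexive) auto
  then show ?thesis
    using sorted_index_tuples[of ns] unfolding distinct_conv_nth sorted_wrt_iff_nth_less
    by (metis nat_neq_iff)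
qed

lemma sum_multi_indices:
  fixes f :: "nat list \<Rightarrow> 'a :: comm_monoid_add"
  shows "sum f (multi_indices ns) =
         (\<Sum>k = 0..<length (index_tuples ns). f (index_tuples ns ! k))"
  using distinct_index_tuples[of ns]
  by (simp add: sum.distinct_set_conv_list sum_list_sum_nth flip: set_index_tuples)

lemma multi_index_upt: "length xs = n \<Longrightarrow> multi_index n [0..<n] xs = xs"
proof (rule nth_equalityI)
  fix i assume "length xs = n" "i < length (multi_index n [0..<n] xs)"
  then show "multi_index n [0..<n] xs ! i = xs ! i"
    using multi_index_nth[of "[0..<n]" n xs i] by (simp add: lessThan_atLeast0 multi_index_def)
qed (simp add: multi_index_def)

text \<open>As partial functions from positions to values, the two blocks have disjoint domains.\<close>

lemma multi_index_append_commute: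
  assumes "set ks \<inter> set ls = {}" and "length vs = length ks" and "length ws = length ls"
  shows "multi_index d (ks @ ls) (vs @ ws) = multi_index d (ls @ ks) (ws @ vs)"
proof -
  have "map_of (zip ls ws) ++ map_of (zip ks vs) = map_of (zip ks vs) ++ map_of (zip ls ws)"
    using assms by (intro map_add_comm) auto
  then show ?thesis
    using assms by (simp add: multi_index_def)
qed

lemma set_remaining: "set (remaining d ks) = {..<d} - set ks"
  by (auto simp: remaining_def)

lemma length_remaining:
  assumes "distinct ks" and "set ks \<subseteq> {..<d}"
  shows "length (remaining d ks) = d - length ks"
proof -
  have "length (remaining d ks) = card (set (remaining d ks))"
    by (rule distinct_card[symmetric]) (simp add: remaining_def)
  then show ?thesis
    using assms by (simp add: set_remaining card_Diff_subset distinct_card)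
qed

text \<open>This is the definition with the contracted positions of \<open>B\<close> moved in front of its remaining
  positions, which is the order in which they label the rows and columns of a matrix expression.\<close>

lemma entry_contracted_product:
  fixes A B :: "'a :: comm_semiring_0 hypermatrix" and \<alpha> \<beta> :: "nat list"
  defines "p \<equiv> remaining (hyper_order A) \<alpha>" and "q \<equiv> remaining (hyper_order B) \<beta>"
  assumes "length \<alpha> = length \<beta>"
    and xs: "xs \<in> multi_indices (map ((!) (dims A)) p)"
    and ys: "ys \<in> multi_indices (map ((!) (dims B)) q)"
  shows "entry (contracted_product A \<alpha> \<beta> B) (xs @ ys) =
         (\<Sum>ks \<in> multi_indices (map ((!) (dims A)) \<alpha>).
            entry A (multi_index (hyper_order A) (p @ \<alpha>) (xs @ ks)) *
            entry B (multi_index (hyper_order B) (\<beta> @ q) (ks @ ys)))"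
proof -
  have len: "length xs = length p" "length ys = length q"
    using xs ys by (auto dest: length_multi_indices)
  have "multi_index (hyper_order B) (q @ \<beta>) (ys @ ks) =
        multi_index (hyper_order B) (\<beta> @ q) (ks @ ys)"
    if "ks \<in> multi_indices (map ((!) (dims A)) \<alpha>)" for ks
    using that assms(3) len(2)
    by (intro multi_index_append_commute) (auto simp: q_def set_remaining dest: length_multi_indices)
  then show ?thesis
    using append_in_multi_indices[OF xs ys] len
    by (simp add: contracted_product_def Let_def flip: p_def q_def)
qed

theorem proposition12:
  fixes A B C :: "'a :: field hypermatrix"
    and d r s :: nat
    and \<alpha> \<beta> :: "nat list"
  assumes "hyper_order A = d" and "hyper_order B = r"
    and "s \<le> min d r"
    and "length \<alpha> = s" and "distinct \<alpha>" and "set \<alpha> \<subseteq> {..<d}"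
    and "length \<beta> = s" and "distinct \<beta>" and "set \<beta> \<subseteq> {..<r}"
    and "\<And>t. t < s \<Longrightarrow> dims A ! (\<alpha> ! t) = dims B ! (\<beta> ! t)"
    and "C = contracted_product A \<alpha> \<beta> B"
  shows "matrix_expression C [0..<d - s] [d - s..<(d - s) + (r - s)] =
         matrix_expression A (remaining d \<alpha>) \<alpha> * matrix_expression B \<beta> (remaining r \<beta>)"
proof -
  define p q where "p = remaining d \<alpha>" and "q = remaining r \<beta>"
  define nA nB ns where "nA = map ((!) (dims A)) p" and "nB = map ((!) (dims B)) q"
    and "ns = map ((!) (dims A)) \<alpha>"
  have lenA: "length nA = d - s" and lenB: "length nB = r - s"
    using assms by (simp_all add: nA_def nB_def p_def q_def length_remaining)
  have ns: "map ((!) (dims B)) \<beta> = ns"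
    using assms by (auto simp: ns_def intro!: nth_equalityI)
  have dimC: "dims C = nA @ nB"
    using assms by (simp add: contracted_product_def Let_def nA_def nB_def p_def q_def)
  have ordC: "hyper_order C = (d - s) + (r - s)"
    by (simp add: hyper_order_def dimC lenA lenB)
  have rowsC: "map ((!) (dims C)) [0..<d - s] = nA"
    by (rule nth_equalityI) (auto simp: dimC lenA nth_append)
  have colsC: "map ((!) (dims C)) [d - s..<(d - s) + (r - s)] = nB"
    by (rule nth_equalityI) (auto simp: dimC lenA lenB nth_append)
  have upt: "[0..<d - s] @ [d - s..<(d - s) + (r - s)] = [0..<(d - s) + (r - s)]"
    using upt_add_eq_append[of 0 "d - s" "r - s"] by simp
  have entryC: "entry C (multi_index ((d - s) + (r - s)) [0..<(d - s) + (r - s)] (xs @ ys)) =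
      (\<Sum>k = 0..<length (index_tuples ns).
         entry A (multi_index d (p @ \<alpha>) (xs @ index_tuples ns ! k)) *
         entry B (multi_index r (\<beta> @ q) (index_tuples ns ! k @ ys)))"
    if "xs \<in> multi_indices nA" "ys \<in> multi_indices nB" for xs ys
  proof -
    have "multi_index ((d - s) + (r - s)) [0..<(d - s) + (r - s)] (xs @ ys) = xs @ ys"
      using that by (intro multi_index_upt) (simp add: length_multi_indices lenA lenB)
    then show ?thesis
      using entry_contracted_product[of \<alpha> \<beta> xs A ys B] that assms
      by (simp add: nA_def nB_def p_def q_def sum_multi_indices flip: ns_def)
  qed
  show ?thesis
    unfolding matrix_expression_def Let_def ordC rowsC colsC upt ns
    unfolding assms(1,2) p_def[symmetric] q_def[symmetric]
      nA_def[symmetric] nB_def[symmetric] ns_def[symmetric]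
    by (rule eq_matI) (simp_all add: scalar_prod_def entryC flip: set_index_tuples)
qed

end
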